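(* Let $H=\langle m_0,\dots,m_p,n\rangle$ be a numerical semigroup minimally generated by an almost arithmetic sequence, with associated data as in the context, and assume $W\ne\emptyset$. Suppose $r'=1$, $\mu>0$ and $q'>0$. Then for each $\alpha_i\in\mathrm{PF}_1(H)$, $i\in[1,p]$, there exists an $\mathrm{RF}$-matrix for $\alpha_i$ whose rows (indexed by $0,1,\dots,p,n$) are: (1) row $0$: $-E_0+(q'-1)E_p+(v-1)E_n+E_i$; (2) row $j$ for $j\in[1,p-i]$: $-E_j+(q'-1)E_p+(v-1)E_n+E_{i+j}$; (3) row $j$ for $j\in[p-i+1,p]$: $(\nu-2)E_0-E_j+(w-1)E_n+E_{i+j-p-1}$; (4) row $n$: $(\mu-1)E_0+(q'+q_z-1)E_p-E_n+E_i+E_{r_z}$.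
   Context: Notation: $\mathbb N=\{0,1,2,\dots\}$; $[a,b]$ is the set of integers $i$ with $a\le i\le b$. Let $p\ge1$, $d\ge1$, $m_0\ge 1$ be integers, $m_i=m_0+id$ for $i\in[0,p]$, and $n\ge1$ an integer with $\gcd(m_0,d,n)=1$. Put $H'=\sum_{i=0}^p\mathbb Nm_i$ and $H=H'+\mathbb Nn=\langle m_0,\dots,m_p,n\rangle$; assume $\{m_0,\dots,m_p,n\}$ is a minimal generating set of $H$. $\mathrm{Ap}(H,m_0)=\{h\in H: h-m_0\notin H\}$. For $t\in\mathbb N$ write $t=q_tp+r_t$ with $q_t\in\mathbb Z$, $r_t\in[1,p]$, and set $g_t=q_tm_p+m_{r_t}$ (so $q_0=-1$, $r_0=p$, $g_0=0$). Let $u=\min\{t\in\mathbb N: g_t\notin\mathrm{Ap}(H,m_0)\}$ and $v=\min\{b\ge1: bn\in H'\}$. It is known (Patil–Singh) that there are unique integers $z\in[0,u-1]$, $w\in[0,v-1]$, $\lambda\ge1$, $\mu\ge0$ with $g_u=\lambda m_0+wn$, $vn=\mu m_0+g_z$, and $g_{u-z}+(v-w)n=\nu m_0$, where $\nu=\lambda+\mu+1$ if $r_{u-z}<r_u$ and $\nu=\lambda+\mu$ if $r_{u-z}\ge r_u$. Set $r=r_u$, $q=q_u$, $r'=r_{u-z}$, $q'=q_{u-z}$, and $W=[u-z,u-1]\times[v-w,v-1]$ (empty iff $z=0$ or $w=0$). $\mathrm{PF}(H)$ is the set of $f\in\mathbb Z\setminus H$ with $f+h\in H$ for all $h\in H\setminus\{0\}$.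 An $\mathrm{RF}$-matrix for $f\in\mathrm{PF}(H)$ is a $(p+2)\times(p+2)$ integer matrix with rows and columns indexed by $0,1,\dots,p,n$ (corresponding to the generators $m_0,\dots,m_p,n$), with all diagonal entries $-1$, all off-diagonal entries in $\mathbb N$, and such that each row $(b_0,\dots,b_p,b_n)$ satisfies $\sum_{j=0}^p b_jm_j+b_nn=f$. $E_0,\dots,E_p,E_n$ denote the standard basis vectors of $\mathbb Z^{p+2}$ (coordinates indexed by $0,\dots,p,n$). When $W\neq\emptyset$, let $\alpha_i=g_{(q'-1)p+i}+(v-1)n-m_0$ for $i\in I$, where $I=\{p\}$ if $r'=1,q'=0$; $I=[1,p]$ if $r'=1,q'>0$; $I=[p+1,p+r'-1]$ if $r'\ge2$. $\mathrm{PF}_1(H)$ denotes the set of pseudo-Frobenius numbers of $H$ of the form $\alpha_i$, $i\in I$. *)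

theory Defs
  imports Complex_Main "Jordan_Normal_Form.Matrix"
begin

text \<open>The additive monoid generated by a set of integers; it is only used for finite sets,
  since \<^const>\<open>sum\<close> vanishes on infinite ones.\<close>

definition nat_span :: "int set \<Rightarrow> int set" where
  "nat_span S = {\<Sum>s\<in>S. int (c s) * s | c :: int \<Rightarrow> nat. True}"

definition minimal_generating_set :: "int set \<Rightarrow> int set \<Rightarrow> bool" where
  "minimal_generating_set S H \<longleftrightarrow> nat_span S = H \<and> (\<forall>T. T \<subset> S \<longrightarrow> nat_span T \<noteq> H)"

definition Ap :: "int set \<Rightarrow> int \<Rightarrow> int set" where
  "Ap H a = {h \<in> H. h - a \<notin> H}"

definition PF :: "int set \<Rightarrow> int set" where
  "PF H = {f. f \<notin> H \<and> (\<forall>h \<in> H - {0}. f + h \<in> H)}"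

definition RF_matrix :: "int vec \<Rightarrow> int \<Rightarrow> int mat \<Rightarrow> bool" where
  "RF_matrix a f A \<longleftrightarrow>
     f \<in> PF (nat_span (set\<^sub>v a)) \<and>
     A \<in> carrier_mat (dim_vec a) (dim_vec a) \<and>
     (\<forall>i < dim_vec a. A $$ (i, i) = -1) \<and>
     (\<forall>i < dim_vec a. \<forall>j < dim_vec a. i \<noteq> j \<longrightarrow> A $$ (i, j) \<ge> 0) \<and>
     (\<forall>i < dim_vec a. row A i \<bullet> a = f)"


definition aa_m :: "nat \<Rightarrow> nat \<Rightarrow> nat \<Rightarrow> int" where
  "aa_m d m0 i = int m0 + int i * int d"

text \<open>The generators in the order \<open>m\<^sub>0, \<dots>, m\<^sub>p, n\<close>: the row and column
  belonging to \<open>n\<close> have index \<open>p + 1\<close>.\<close>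

definition aa_gens :: "nat \<Rightarrow> nat \<Rightarrow> nat \<Rightarrow> nat \<Rightarrow> int vec" where
  "aa_gens p d m0 n = vec (p + 2) (\<lambda>i. if i \<le> p then aa_m d m0 i else int n)"

definition aa_H' :: "nat \<Rightarrow> nat \<Rightarrow> nat \<Rightarrow> int set" where
  "aa_H' p d m0 = nat_span (aa_m d m0 ` {0..p})"

definition aa_H :: "nat \<Rightarrow> nat \<Rightarrow> nat \<Rightarrow> nat \<Rightarrow> int set" where
  "aa_H p d m0 n = nat_span (insert (int n) (aa_m d m0 ` {0..p}))"

definition almost_arithmetic :: "nat \<Rightarrow> nat \<Rightarrow> nat \<Rightarrow> nat \<Rightarrow> bool" where
  "almost_arithmetic p d m0 n \<longleftrightarrow>
     p \<ge> 1 \<and> d \<ge> 1 \<and> m0 \<ge> 1 \<and> n \<ge> 1 \<and> Gcd {m0, d, n} = 1 \<and>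
     minimal_generating_set (insert (int n) (aa_m d m0 ` {0..p})) (aa_H p d m0 n)"

text \<open>The decomposition \<open>t = q p + r\<close> with \<open>r \<in> [1, p]\<close>, so that the quotient of \<open>0\<close> is \<open>-1\<close>.\<close>

definition aa_q :: "nat \<Rightarrow> nat \<Rightarrow> int" where
  "aa_q p t = (int t - 1) div int p"

definition aa_r :: "nat \<Rightarrow> nat \<Rightarrow> nat" where
  "aa_r p t = nat ((int t - 1) mod int p) + 1"

lemma aa_q_r_unique:
  assumes "p \<ge> 1"
  shows "int t = q * int p + int r \<and> r \<in> {1..p} \<longleftrightarrow> q = aa_q p t \<and> r = aa_r p t"
proof
  assume A: "int t = q * int p + int r \<and> r \<in> {1..p}"
  then have e: "int t - 1 = q * int p + int (r - 1)" and l: "int (r - 1) < int p" by auto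
  from l have "(int t - 1) div int p = q" "(int t - 1) mod int p = int (r - 1)"
    unfolding e by auto
  then show "q = aa_q p t \<and> r = aa_r p t" using A by (auto simp: aa_q_def aa_r_def)
next
  assume A: "q = aa_q p t \<and> r = aa_r p t"
  have b: "0 \<le> (int t - 1) mod int p" "(int t - 1) mod int p < int p" using assms by auto
  then have "int r = (int t - 1) mod int p + 1" using A by (simp add: aa_r_def)
  moreover have "(int t - 1) div int p * int p + (int t - 1) mod int p = int t - 1" by simp
  ultimately show "int t = q * int p + int r \<and> r \<in> {1..p}" using A b unfolding aa_q_def by auto
qed

definition aa_g :: "nat \<Rightarrow> nat \<Rightarrow> nat \<Rightarrow> nat \<Rightarrow> int" where
  "aa_g p d m0 t = aa_q p t * aa_m d m0 p + aa_m d m0 (aa_r p t)"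

definition aa_u :: "nat \<Rightarrow> nat \<Rightarrow> nat \<Rightarrow> nat \<Rightarrow> nat" where
  "aa_u p d m0 n = (LEAST t. aa_g p d m0 t \<notin> Ap (aa_H p d m0 n) (int m0))"

definition aa_v :: "nat \<Rightarrow> nat \<Rightarrow> nat \<Rightarrow> nat \<Rightarrow> nat" where
  "aa_v p d m0 n = (LEAST b. b \<ge> 1 \<and> int b * int n \<in> aa_H' p d m0)"

definition aa_nu :: "nat \<Rightarrow> nat \<Rightarrow> nat \<Rightarrow> nat \<Rightarrow> nat \<Rightarrow> nat \<Rightarrow> nat \<Rightarrow> nat" where
  "aa_nu p d m0 n z lam mu =
     (if aa_r p (aa_u p d m0 n - z) < aa_r p (aa_u p d m0 n) then lam + mu + 1 else lam + mu)"

text \<open>The relations of Patil and Singh that determine \<open>z\<close>, \<open>w\<close>, \<open>\<lambda>\<close>, \<open>\<mu>\<close>.\<close>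

definition patil_singh :: "nat \<Rightarrow> nat \<Rightarrow> nat \<Rightarrow> nat \<Rightarrow> nat \<Rightarrow> nat \<Rightarrow> nat \<Rightarrow> nat \<Rightarrow> bool" where
  "patil_singh p d m0 n z w lam mu \<longleftrightarrow>
     (let u = aa_u p d m0 n; v = aa_v p d m0 n; g = aa_g p d m0 in
       z < u \<and> w < v \<and> lam \<ge> 1 \<and>
       g u = int lam * int m0 + int w * int n \<and>
       int v * int n = int mu * int m0 + g z \<and>
       g (u - z) + int (v - w) * int n = int (aa_nu p d m0 n z lam mu) * int m0)"

definition aa_W :: "nat \<Rightarrow> nat \<Rightarrow> nat \<Rightarrow> nat \<Rightarrow> nat \<Rightarrow> nat \<Rightarrow> (nat \<times> nat) set" where
  "aa_W p d m0 n z w =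
     (let u = aa_u p d m0 n; v = aa_v p d m0 n in {u - z..u - 1} \<times> {v - w..v - 1})"

text \<open>In the next two definitions, \<open>q'\<close> and \<open>r'\<close> are the quotient and remainder of \<open>u - z\<close>.
  For \<open>i \<in> I\<close> the argument \<open>(q' - 1) p + i\<close> of \<open>g\<close> is nonnegative, so \<^const>\<open>nat\<close> does not truncate.\<close>

definition aa_alpha :: "nat \<Rightarrow> nat \<Rightarrow> nat \<Rightarrow> nat \<Rightarrow> nat \<Rightarrow> nat \<Rightarrow> int" where
  "aa_alpha p d m0 n z i =
     (let q' = aa_q p (aa_u p d m0 n - z) in
       aa_g p d m0 (nat ((q' - 1) * int p + int i)) + (int (aa_v p d m0 n) - 1) * int n - int m0)"

definition aa_I :: "nat \<Rightarrow> nat \<Rightarrow> nat \<Rightarrow> nat \<Rightarrow> nat \<Rightarrow> nat set" where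
  "aa_I p d m0 n z =
     (let q' = aa_q p (aa_u p d m0 n - z); r' = aa_r p (aa_u p d m0 n - z) in
       if r' = 1 then (if q' = 0 then {p} else {1..p}) else {p + 1..p + r' - 1})"

definition PF1 :: "nat \<Rightarrow> nat \<Rightarrow> nat \<Rightarrow> nat \<Rightarrow> nat \<Rightarrow> int set" where
  "PF1 p d m0 n z = {aa_alpha p d m0 n z i | i. i \<in> aa_I p d m0 n z} \<inter> PF (aa_H p d m0 n)"

lemma set_aa_gens: "set\<^sub>v (aa_gens p d m0 n) = insert (int n) (aa_m d m0 ` {0..p})"
proof -
  have "{..<p + 2} = insert (p + 1) {0..p}" by auto
  then show ?thesis by (simp add: vec_set_def aa_gens_def)
qed

end

theory Submission
  imports Defs
begin

text \<open>Every value is computed from \<open>\<alpha>\<^sub>i = (q' - 1) m\<^sub>p + m\<^sub>i + (v - 1) n - m\<^sub>0\<close>.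
  Rows \<open>0\<close> and \<open>j \<le> p - i\<close> only use \<open>m\<^sub>i - m\<^sub>0 = m\<^bsub>i+j\<^esub> - m\<^sub>j\<close>. Substituting
  \<open>q' m\<^sub>p + m\<^sub>1 + (v - w) n = \<nu> m\<^sub>0\<close> gives the rows \<open>j > p - i\<close>, and substituting
  \<open>v n = \<mu> m\<^sub>0 + q\<^sub>z m\<^sub>p + m\<^bsub>r\<^sub>z\<^esub>\<close> gives row \<open>n\<close>. The coefficients are nonnegative because
  \<open>W \<noteq> \<emptyset>\<close> forces \<open>z, w \<ge> 1\<close>, hence \<open>q\<^sub>z \<ge> 0\<close>, and \<open>\<mu> > 0\<close> forces \<open>\<nu> \<ge> 2\<close>.\<close>

text \<open>The theorem prescribes rows, so the matrix is assembled from a row function and every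
  condition can be checked one row vector at a time.\<close>

lemma RF_matrix_of_rows:
  assumes "f \<in> PF (nat_span (set\<^sub>v a))"
    and "\<And>i. i < dim_vec a \<Longrightarrow> R i \<in> carrier_vec (dim_vec a)"
    and "\<And>i. i < dim_vec a \<Longrightarrow> R i $ i = -1"
    and "\<And>i j. i < dim_vec a \<Longrightarrow> j < dim_vec a \<Longrightarrow> i \<noteq> j \<Longrightarrow> R i $ j \<ge> 0"
    and "\<And>i. i < dim_vec a \<Longrightarrow> R i \<bullet> a = f"
  shows "\<exists>A. RF_matrix a f A \<and> (\<forall>i < dim_vec a. row A i = R i)"
proof -
  define A where "A = mat (dim_vec a) (dim_vec a) (\<lambda>(i, j). R i $ j)"
  have "row A i = R i" if "i < dim_vec a" for i
    using assms(2)[OF that] that by (intro eq_vecI) (auto simp: A_def)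
  then have "RF_matrix a f A \<and> (\<forall>i < dim_vec a. row A i = R i)"
    using assms by (auto simp: RF_matrix_def A_def)
  then show ?thesis ..
qed

lemma aa_r_bounds: "p \<ge> 1 \<Longrightarrow> aa_r p t \<in> {1..p}"
  using aa_q_r_unique by blast

lemma aa_q_nonneg: "t \<ge> 1 \<Longrightarrow> p \<ge> 1 \<Longrightarrow> aa_q p t \<ge> 0"
  by (simp add: aa_q_def pos_imp_zdiv_nonneg_iff)

lemma aa_g_eq:
  assumes "int t = q * int p + int r" "r \<in> {1..p}"
  shows "aa_g p d m0 t = q * aa_m d m0 p + aa_m d m0 r"
proof -
  have "q = aa_q p t \<and> r = aa_r p t"
    using aa_q_r_unique[of p t q r] assms by auto
  then show ?thesis by (simp add: aa_g_def)
qed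

text \<open>With z = 0 the first factor is \<open>{u..u - 1}\<close>. It is empty because z < u
  makes u positive, so the subtraction on naturals does not truncate; likewise for w and v.\<close>

lemma aa_W_nonempty:
  "aa_W p d m0 n z w \<noteq> {} \<Longrightarrow>
    z < aa_u p d m0 n \<Longrightarrow> w < aa_v p d m0 n \<Longrightarrow> z \<ge> 1 \<and> w \<ge> 1"
  by (auto simp: aa_W_def Let_def)

text \<open>As i lies in [1,p], the argument (q' - 1) p + i of g already displays its quotient q' -
  1 and remainder i.\<close>

lemma aa_alpha_eq:
  assumes "i \<in> {1..p}" "aa_q p (aa_u p d m0 n - z) > 0"
  shows "aa_alpha p d m0 n z i =
    (aa_q p (aa_u p d m0 n - z) - 1) * aa_m d m0 p + aa_m d m0 i
      + (int (aa_v p d m0 n) - 1) * int n - int m0"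
proof -
  define q where "q = aa_q p (aa_u p d m0 n - z)"
  have "0 \<le> (q - 1) * int p" using assms(2) by (simp add: q_def)
  then have "int (nat ((q - 1) * int p + int i)) = (q - 1) * int p + int i" by simp
  from aa_g_eq[OF this assms(1)] show ?thesis
    by (simp only: aa_alpha_def Let_def q_def)
qed

lemma dim_aa_gens [simp]: "dim_vec (aa_gens p d m0 n) = p + 2"
  by (simp add: aa_gens_def)

text \<open>The dimension is written with \<open>Suc\<close> because the simplifier rewrites \<open>p + 2\<close> to this form.\<close>

lemma aa_gens_carrier [simp]: "aa_gens p d m0 n \<in> carrier_vec (Suc (Suc p))"
  by (rule carrier_vecI) simp

lemma unit_scalar_prod_aa_gens:
  "k < p + 2 \<Longrightarrow> unit_vec (p + 2) k \<bullet> aa_gens p d m0 n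
    = (if k \<le> p then aa_m d m0 k else int n)"
  by (subst scalar_prod_left_unit[of _ "p + 2"]) (auto simp: aa_gens_def)

theorem proposition4p3:
  fixes p d m0 n z w lam mu u v nu r' :: nat
    and q' :: int
    and E :: "nat \<Rightarrow> int vec"
  assumes "almost_arithmetic p d m0 n"
    and "patil_singh p d m0 n z w lam mu"
    and "u = aa_u p d m0 n" and "v = aa_v p d m0 n" and "nu = aa_nu p d m0 n z lam mu"
    and "q' = aa_q p (u - z)" and "r' = aa_r p (u - z)"
    and "E = unit_vec (p + 2)"
    and "aa_W p d m0 n z w \<noteq> {}"
    and "r' = 1" and "mu > 0" and "q' > 0"
  shows "\<forall>i \<in> {1..p}. aa_alpha p d m0 n z i \<in> PF1 p d m0 n z \<longrightarrow>
    (\<exists>A. RF_matrix (aa_gens p d m0 n) (aa_alpha p d m0 n z i) A \<and>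
      row A 0 = - E 0 + (q' - 1) \<cdot>\<^sub>v E p + (int v - 1) \<cdot>\<^sub>v E (p + 1) + E i \<and>
      (\<forall>j \<in> {1..p - i}.
        row A j = - E j + (q' - 1) \<cdot>\<^sub>v E p + (int v - 1) \<cdot>\<^sub>v E (p + 1) + E (i + j)) \<and>
      (\<forall>j \<in> {p - i + 1..p}.
        row A j = (int nu - 2) \<cdot>\<^sub>v E 0 - E j + (int w - 1) \<cdot>\<^sub>v E (p + 1) + E (i + j - p - 1)) \<and>
      row A (p + 1) =
        (int mu - 1) \<cdot>\<^sub>v E 0 + (q' + aa_q p z - 1) \<cdot>\<^sub>v E p - E (p + 1) + E i + E (aa_r p z))"
proof (intro ballI impI)
  fix i assume i: "i \<in> {1..p}" and PF1: "aa_alpha p d m0 n z i \<in> PF1 p d m0 n z"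
  have p: "p \<ge> 1" using i by auto
  let ?a = "aa_gens p d m0 n" and ?f = "aa_alpha p d m0 n z i" and ?m = "aa_m d m0"
  have rel: "w < v" "lam \<ge> 1" "int v * int n = int mu * int m0 + aa_g p d m0 z"
      "aa_g p d m0 (u - z) + int (v - w) * int n = int nu * int m0"
    using assms(2-5) by (auto simp: patil_singh_def Let_def)
  have zw: "z \<ge> 1" "w \<ge> 1"
    using aa_W_nonempty[OF assms(9)] assms(2) by (auto simp: patil_singh_def Let_def)
  have nu: "nu \<ge> 2" using rel(2) assms(5,11) by (auto simp: aa_nu_def)
  have qz: "aa_q p z \<ge> 0" and rz: "aa_r p z \<in> {1..p}"
    using aa_q_nonneg aa_r_bounds zw p by auto
  have vn: "int v * int n = int mu * int m0 + aa_q p z * ?m p + ?m (aa_r p z)"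
    using rel(3) by (simp add: aa_g_def)
  \<comment> \<open>r' = 1 turns g at u - z into q' m_p + m_1, and w < v lets the natural difference
    v - w pass to integers.\<close>
  have num: "q' * ?m p + ?m 1 + (int v - int w) * int n = int nu * int m0"
    using rel(1,4) assms(6,7,10) by (simp add: aa_g_def of_nat_diff)
  have f: "?f = (q' - 1) * ?m p + ?m i + (int v - 1) * int n - int m0"
    using aa_alpha_eq[OF i] assms(3,4,6,12) by simp
  \<comment> \<open>Row 0 is the case j = 0 of the first branch.\<close>
  define R where "R j =
     (if j \<le> p - i then - E j + (q' - 1) \<cdot>\<^sub>v E p + (int v - 1) \<cdot>\<^sub>v E (p + 1) + E (i + j)
      else if j \<le> p then
        (int nu - 2) \<cdot>\<^sub>v E 0 - E j + (int w - 1) \<cdot>\<^sub>v E (p + 1) + E (i + j - p - 1)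
      else (int mu - 1) \<cdot>\<^sub>v E 0 + (q' + aa_q p z - 1) \<cdot>\<^sub>v E p - E (p + 1) + E i + E (aa_r p z))"
    for j
  have E [simp]: "E k \<in> carrier_vec (Suc (Suc p))" for k by (simp add: assms(8))
  have dE [simp]: "dim_vec (E k) = p + 2" for k by (simp add: assms(8))
  have Ea: "E k \<bullet> ?a = (if k \<le> p then ?m k else int n)" if "k < p + 2" for k
    using unit_scalar_prod_aa_gens that assms(8) by simp
  have Ek: "E k $ l = (if l = k then 1 else 0)" if "k < p + 2" "l < p + 2" for k l
    using that by (simp add: assms(8))
  note distrib = add_scalar_prod_distrib[where n = "Suc (Suc p)"]
    minus_scalar_prod_distrib[where n = "Suc (Suc p)"] smult_scalar_prod_distrib[where n = "Suc (Suc p)"]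
  have "R j \<bullet> ?a = ?f" if "j < p + 2" for j
  proof -
    consider "j \<le> p - i" | "p - i < j" "j \<le> p" | "j = p + 1" using \<open>j < p + 2\<close> by linarith
    then show ?thesis
    proof cases
      case 1
      then have "i + j \<le> p" "j \<le> p" using i by auto
      with 1 have "R j \<bullet> ?a = - ?m j + (q' - 1) * ?m p + (int v - 1) * int n + ?m (i + j)"
        using i by (simp add: R_def distrib Ea)
      then show ?thesis by (simp add: f aa_m_def algebra_simps)
    next
      case 2
      have "i + j - Suc p \<le> p" using i 2 by auto
      with 2 have "R j \<bullet> ?a = (int nu - 2) * ?m 0 - ?m j + (int w - 1) * int n + ?m (i + j - p - 1)"
        using i by (simp add: R_def distrib Ea)
      \<comment> \<open>No truncation, as j > p - i. Hence m_{i+j-p-1} + m_p + m_1 = m_0 + m_i +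
        m_j, which brings the row into the reach of \<open>num\<close>.\<close>
      moreover have "int (i + j - p - 1) = int i + int j - int p - 1" using 2 by linarith
      ultimately show ?thesis using num by (simp add: f aa_m_def algebra_simps)
    next
      case 3
      then have "\<not> j \<le> p - i" by simp
      with 3 have "R j \<bullet> ?a = (int mu - 1) * ?m 0 + (q' + aa_q p z - 1) * ?m p - int n + ?m i
          + ?m (aa_r p z)"
        using i rz by (simp add: R_def distrib Ea)
      then show ?thesis using vn by (simp add: f aa_m_def algebra_simps)
    qed
  qed
  moreover have "?f \<in> PF (nat_span (set\<^sub>v ?a))"
    using PF1 by (simp add: PF1_def set_aa_gens aa_H_def)
  moreover have "R j \<in> carrier_vec (p + 2)" for j by (simp add: R_def)
  \<comment> \<open>No other unit vector of row j meets the diagonal: j < p and i + j > j in the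
    first branch, j > 0 and i + j - p - 1 < j in the second, and i and r_z are at most p in the
    last.\<close>
  moreover have "R j $ j = -1" if "j < p + 2" for j
    using that i rz by (auto simp: R_def Ek)
  \<comment> \<open>The coefficient v - 1 is nonnegative by w < v, and q' + q_z - 1 by q' > 0
    together with \<open>qz\<close>.\<close>
  moreover have "R j $ k \<ge> 0" if "j < p + 2" "k < p + 2" "j \<noteq> k" for j k
    using that i rz qz nu zw rel(1) assms(11,12) by (auto simp: R_def Ek)
  ultimately obtain A where A: "RF_matrix ?a ?f A" "\<And>j. j < p + 2 \<Longrightarrow> row A j = R j"
    using RF_matrix_of_rows[where a = ?a and f = ?f and R = R] by auto
  show "\<exists>A. RF_matrix ?a ?f A \<and>
      row A 0 = - E 0 + (q' - 1) \<cdot>\<^sub>v E p + (int v - 1) \<cdot>\<^sub>v E (p + 1) + E i \<and>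
      (\<forall>j \<in> {1..p - i}.
        row A j = - E j + (q' - 1) \<cdot>\<^sub>v E p + (int v - 1) \<cdot>\<^sub>v E (p + 1) + E (i + j)) \<and>
      (\<forall>j \<in> {p - i + 1..p}.
        row A j = (int nu - 2) \<cdot>\<^sub>v E 0 - E j + (int w - 1) \<cdot>\<^sub>v E (p + 1) + E (i + j - p - 1)) \<and>
      row A (p + 1) =
        (int mu - 1) \<cdot>\<^sub>v E 0 + (q' + aa_q p z - 1) \<cdot>\<^sub>v E p - E (p + 1) + E i + E (aa_r p z)"
    using A by (intro exI[of _ A]) (auto simp: R_def)
qed

end
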